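(* Every positive solution $(a_n,b_n)_{n\in\mathbb{N}}$ of the recurrence relations $$a_n+a_{n+1}=b_n^2\quad(n\ge0),\qquad 3a_n(b_n+b_{n-1})=n\quad(n\ge1)$$ has the property that $$\lim_{n\to\infty}\frac{a_n}{n^{2/3}}=\frac{1}{2\cdot 3^{2/3}},\qquad \lim_{n\to\infty}\frac{b_n}{n^{1/3}}=\frac{1}{3^{1/3}}.$$
   Context: $\mathbb{N}=\{0,1,2,\ldots\}$. A positive solution is a pair of real sequences $(a_n)_{n\in\mathbb{N}}$, $(b_n)_{n\in\mathbb{N}}$ satisfying both recurrence relations with $a_0=0$ and $a_{n+1}>0$, $b_n>0$ for all $n\in\mathbb{N}$ (no particular value of $b_0$ is prescribed). *)

theory Defs
  imports "HOL-Analysis.Analysis"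
begin

definition positive_solution :: "(nat \<Rightarrow> real) \<Rightarrow> (nat \<Rightarrow> real) \<Rightarrow> bool" where
  "positive_solution a b \<longleftrightarrow>
     (\<forall>n. a n + a (n + 1) = (b n)\<^sup>2) \<and>
     (\<forall>n\<ge>1. 3 * a n * (b n + b (n - 1)) = real n) \<and>
     a 0 = 0 \<and> (\<forall>n. a (n + 1) > 0 \<and> b n > 0)"

end

theory Submission
  imports Defs "HOL-Real_Asymp.Real_Asymp"
begin

text \<open>
  Put x n = a n / n powr (2/3). Eliminating b gives
  3 x n (sqrt (x n + x (n+1) s) + sqrt (x n + x (n-1) t)) = 1 with s, t tending to 1.
  Hence x is bounded, and if x tends to L along a subsequence, then
  3 L (sqrt (L + p) + sqrt (L + q)) = 1 for some p, q between m = liminf x and M = limsup x.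
  Taking L = M and L = m yields 6 M sqrt (M + m) \<le> 1 \<le> 6 m sqrt (m + M), so M = m,
  and the common value solves 6 m sqrt (2 m) = 1.
\<close>

text \<open>Supplies m = liminf and M = limsup as real numbers, each reached along a subsequence.
  They are formed in \<open>ereal\<close>, where they always exist; the bounds l and u force both to
  be finite.\<close>

lemma bounded_liminf_limsup_real:
  fixes x :: "nat \<Rightarrow> real"
  assumes bd: "\<And>n. l \<le> x n" "\<And>n. x n \<le> u"
  obtains r m s M where
    "strict_mono (r :: nat \<Rightarrow> nat)" "(x \<circ> r) \<longlonglongrightarrow> m"
    "strict_mono (s :: nat \<Rightarrow> nat)" "(x \<circ> s) \<longlonglongrightarrow> M"
    "\<And>k. k < m \<Longrightarrow> \<forall>\<^sub>F n in sequentially. k < x n"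
    "\<And>k. M < k \<Longrightarrow> \<forall>\<^sub>F n in sequentially. x n < k"
proof -
  let ?X = "\<lambda>n. ereal (x n)"
  have between: "\<exists>y. e = ereal y" if "ereal l \<le> e" "e \<le> ereal u" for e
    using that by (cases e) auto
  have lo: "ereal l \<le> liminf ?X"
    by (rule Liminf_bounded) (simp add: bd)
  have hi: "limsup ?X \<le> ereal u"
    by (rule Limsup_bounded) (simp add: bd)
  have le: "liminf ?X \<le> limsup ?X"
    by (rule Liminf_le_Limsup) simp
  obtain m where m: "liminf ?X = ereal m"
    using between lo le hi by (meson order_trans)
  obtain M where M: "limsup ?X = ereal M"
    using between lo le hi by (meson order_trans)
  obtain r where r: "strict_mono r" "(?X \<circ> r) \<longlonglongrightarrow> liminf ?X"
    using liminf_subseq_lim by blast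
  obtain s where s: "strict_mono s" "(?X \<circ> s) \<longlonglongrightarrow> limsup ?X"
    using limsup_subseq_lim by blast
  show thesis
  proof
    show "(x \<circ> r) \<longlonglongrightarrow> m" "(x \<circ> s) \<longlonglongrightarrow> M"
      using r(2) s(2) by (simp_all add: m M o_def)
    show "\<forall>\<^sub>F n in sequentially. k < x n" if "k < m" for k
      using less_LiminfD[of "ereal k" sequentially ?X] that by (simp add: m)
    show "\<forall>\<^sub>F n in sequentially. x n < k" if "M < k" for k
      using Limsup_lessD[of sequentially ?X "ereal k"] that by (simp add: M)
  qed (use r s in auto)
qed

text \<open>The x n of the overview. At n = 0 the division by zero yields 0, which agrees with
  \<open>a 0 = 0\<close>, so multiplying back recovers \<open>a n\<close> at every index.\<close>

definition scaled :: "(nat \<Rightarrow> real) \<Rightarrow> nat \<Rightarrow> real" where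
  "scaled a n = a n / real n powr (2/3)"

lemma scaled_mult: "a 0 = 0 \<Longrightarrow> scaled a n * real n powr (2/3) = a n"
  by (cases "n = 0") (simp_all add: scaled_def)

context
  fixes a b :: "nat \<Rightarrow> real"
  assumes sol: "positive_solution a b"
begin

lemma a_0: "a 0 = 0"
  and a_nonneg: "a n \<ge> 0"
  and b_pos: "b n > 0"
  and a_Suc: "a n + a (Suc n) = (b n)\<^sup>2"
  and ab_eq: "n \<ge> 1 \<Longrightarrow> 3 * a n * (b n + b (n - 1)) = real n"
proof -
  show "a 0 = 0" "b n > 0" "a n + a (Suc n) = (b n)\<^sup>2"
    "n \<ge> 1 \<Longrightarrow> 3 * a n * (b n + b (n - 1)) = real n"
    using sol by (auto simp: positive_solution_def)
  show "a n \<ge> 0"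
    using sol by (cases n) (auto simp: positive_solution_def less_imp_le)
qed

lemma scaled_nonneg: "scaled a n \<ge> 0"
  by (simp add: scaled_def a_nonneg)

text \<open>Positivity of b selects the positive root, so b can be eliminated from the second
  recurrence.\<close>

lemma b_eq_sqrt: "b n = sqrt (a n + a (Suc n))"
  using b_pos[of n] by (simp add: a_Suc)

text \<open>Both roots are written on the scale of the same n, so that a common factor can be pulled
  out; the index ratios are the price, and they tend to 1.\<close>

lemma b_eq:
  assumes "n \<ge> 1"
  shows "b n = real n powr (1/3) *
    sqrt (scaled a n + scaled a (Suc n) * (real (Suc n) / real n) powr (2/3))"
    and "b (n - 1) = real n powr (1/3) *
    sqrt (scaled a n + scaled a (n - 1) * (real (n - 1) / real n) powr (2/3))"
proof -
  have sqrt_powr: "sqrt (real n powr (2/3)) = real n powr (1/3)"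
    by (simp flip: powr_half_sqrt add: powr_powr)
  \<comment> \<open>The case k = 0, needed for n = 1, is covered because
    \<open>a 0 = 0\<close>.\<close>
  have *: "real n powr (2/3) * (scaled a n + scaled a k * (real k / real n) powr (2/3)) = a n + a k"
    for k
  proof -
    have "real n powr (2/3) * (real k / real n) powr (2/3) = real k powr (2/3)"
      using assms by (simp add: powr_divide)
    then show ?thesis
      using scaled_mult[of a k] scaled_mult[of a n] a_0
      by (metis (no_types, lifting) distrib_left mult.commute mult.left_commute)
  qed
  show "b n = real n powr (1/3) *
    sqrt (scaled a n + scaled a (Suc n) * (real (Suc n) / real n) powr (2/3))"
    unfolding b_eq_sqrt *[symmetric] real_sqrt_mult sqrt_powr ..
  have "b (n - 1) = sqrt (a n + a (n - 1))"
    using assms b_eq_sqrt[of "n - 1"] by (simp add: add.commute)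
  then show "b (n - 1) = real n powr (1/3) *
    sqrt (scaled a n + scaled a (n - 1) * (real (n - 1) / real n) powr (2/3))"
    unfolding *[symmetric] real_sqrt_mult sqrt_powr .
qed

text \<open>The exponents 2/3 and 1/3 add up to 1, so the powers of n cancel the right-hand side n
  of the recurrence.\<close>

lemma scaled_eq:
  assumes "n \<ge> 1"
  shows "3 * scaled a n *
     (sqrt (scaled a n + scaled a (Suc n) * (real (Suc n) / real n) powr (2/3)) +
      sqrt (scaled a n + scaled a (n - 1) * (real (n - 1) / real n) powr (2/3))) = 1"
    (is "3 * _ * (?s + ?t) = 1")
proof -
  have "real n = 3 * (scaled a n * real n powr (2/3)) *
      (real n powr (1/3) * ?s + real n powr (1/3) * ?t)"
    using ab_eq[OF assms] unfolding b_eq[OF assms] scaled_mult[of a n, OF a_0] by simp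
  also have "\<dots> = (real n powr (2/3) * real n powr (1/3)) * (3 * scaled a n * (?s + ?t))"
    by (simp add: algebra_simps)
  also have "real n powr (2/3) * real n powr (1/3) = real n"
    by (simp flip: powr_add)
  finally show ?thesis
    using assms by simp
qed

text \<open>If x n > 1, both roots are at least 1 because the neighbours are nonnegative, and the
  left side of \<open>scaled_eq\<close> would be at least 6. This crude bound suffices for
  compactness.\<close>

lemma scaled_le_1: "scaled a n \<le> 1"
proof (cases "n = 0")
  case False
  show ?thesis
  proof (rule ccontr)
    assume "\<not> scaled a n \<le> 1"
    then have gt: "scaled a n > 1" by simp
    have ge: "sqrt (scaled a n + scaled a k * c powr (2/3)) \<ge> 1" for k c
      using gt scaled_nonneg[of k] by (simp add: add_increasing2)
    have "3 * 1 * (1 + 1) \<le> 3 * scaled a n *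
     (sqrt (scaled a n + scaled a (Suc n) * (real (Suc n) / real n) powr (2/3)) +
      sqrt (scaled a n + scaled a (n - 1) * (real (n - 1) / real n) powr (2/3)))"
      by (intro mult_mono add_mono ge) (use gt in auto)
    then show False
      using scaled_eq[of n] False by simp
  qed
qed (simp add: scaled_def)

text \<open>Along r the neighbouring terms need not converge, but by compactness they do along a
  further subsequence; p and q are their limits, and \<open>scaled_eq\<close> passes to the
  limit.\<close>

lemma scaled_subseq_limit:
  assumes r: "strict_mono r" and L: "(scaled a \<circ> r) \<longlonglongrightarrow> L"
    and lo: "\<And>k. k < m \<Longrightarrow> \<forall>\<^sub>F n in sequentially. k < scaled a n"
    and hi: "\<And>k. M < k \<Longrightarrow> \<forall>\<^sub>F n in sequentially. scaled a n < k"
  obtains p q where "p \<in> {m..M}" "q \<in> {m..M}" "3 * L * (sqrt (L + p) + sqrt (L + q)) = 1"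
proof -
  \<comment> \<open>Pairing the two neighbours makes one extraction serve both.\<close>
  have "bounded (range (\<lambda>n. (scaled a (Suc (r n)), scaled a (r n - 1))))"
    by (rule bounded_subset[of "{0..1} \<times> {0..1}"])
      (auto intro: bounded_Times simp: scaled_nonneg scaled_le_1)
  then obtain pq s where s: "strict_mono s"
    and pq: "((\<lambda>n. (scaled a (Suc (r n)), scaled a (r n - 1))) \<circ> s) \<longlonglongrightarrow> pq"
    using bounded_imp_convergent_subsequence by blast
  obtain p q where p: "(\<lambda>n. scaled a (Suc (r (s n)))) \<longlonglongrightarrow> p"
    and q: "(\<lambda>n. scaled a (r (s n) - 1)) \<longlonglongrightarrow> q"
    using tendsto_fst[OF pq] tendsto_snd[OF pq] by (auto simp: o_def)
  define t where "t = r \<circ> s"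
  have t: "filterlim t at_top sequentially"
    unfolding t_def using r s by (intro filterlim_subseq strict_mono_o)
  have t1: "filterlim (\<lambda>n. t n - 1) at_top sequentially"
    using filterlim_compose[OF filterlim_minus_const_nat_at_top t] .
  have tS: "filterlim (\<lambda>n. Suc (t n)) at_top sequentially"
    using filterlim_compose[OF filterlim_Suc t] .
  \<comment> \<open>Stated for any f tending to infinity, since the shifted index
    \<open>t n - 1\<close> need not be strictly increasing: truncated subtraction can repeat
    0.\<close>
  have bounds: "y \<in> {m..M}"
    if y: "(\<lambda>n. scaled a (f n)) \<longlonglongrightarrow> y" and f: "filterlim f at_top sequentially" for f y
  proof -
    have "k \<le> y" if "k < m" for k
      using eventually_compose_filterlim[OF lo[OF that] f]
      by (intro tendsto_lowerbound[OF y]) (auto elim: eventually_mono)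
    moreover have "y \<le> k" if "M < k" for k
      using eventually_compose_filterlim[OF hi[OF that] f]
      by (intro tendsto_upperbound[OF y]) (auto elim: eventually_mono)
    ultimately show ?thesis
      by (auto intro: dense_le dense_ge)
  qed
  have Lt: "(\<lambda>n. scaled a (t n)) \<longlonglongrightarrow> L"
    using LIMSEQ_subseq_LIMSEQ[OF L s] by (simp add: t_def o_def)
  have "(\<lambda>n. real (Suc n) / real n) \<longlonglongrightarrow> 1" "(\<lambda>n. real (n - 1) / real n) \<longlonglongrightarrow> 1"
    by real_asymp+
  note ratio = this[THEN filterlim_compose, OF t]
  have lim: "(\<lambda>n. 3 * scaled a (t n) *
     (sqrt (scaled a (t n) + scaled a (Suc (t n)) * (real (Suc (t n)) / real (t n)) powr (2/3)) +
      sqrt (scaled a (t n) + scaled a (t n - 1) * (real (t n - 1) / real (t n)) powr (2/3))))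
    \<longlonglongrightarrow> 3 * L * (sqrt (L + p * 1 powr (2/3)) + sqrt (L + q * 1 powr (2/3)))"
    using p q by (intro tendsto_intros Lt ratio) (auto simp: t_def)
  have "\<forall>\<^sub>F n in sequentially. 3 * scaled a (t n) *
     (sqrt (scaled a (t n) + scaled a (Suc (t n)) * (real (Suc (t n)) / real (t n)) powr (2/3)) +
      sqrt (scaled a (t n) + scaled a (t n - 1) * (real (t n - 1) / real (t n)) powr (2/3))) = 1"
    using eventually_compose_filterlim[OF eventually_ge_at_top[of 1] t]
    by eventually_elim (rule scaled_eq)
  then have "3 * L * (sqrt (L + p) + sqrt (L + q)) = 1"
    using LIMSEQ_unique[OF lim tendsto_eventually] by simp
  moreover have "p \<in> {m..M}" "q \<in> {m..M}"
    using bounds[OF _ tS] bounds[OF _ t1] p q by (auto simp: t_def)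
  ultimately show thesis
    using that by blast
qed

lemma scaled_tendsto: "scaled a \<longlonglongrightarrow> 1 / (2 * 3 powr (2/3))"
proof -
  obtain r m s M where rs:
    "strict_mono (r :: nat \<Rightarrow> nat)" "(scaled a \<circ> r) \<longlonglongrightarrow> m"
    "strict_mono (s :: nat \<Rightarrow> nat)" "(scaled a \<circ> s) \<longlonglongrightarrow> M"
    and lo: "\<And>k. k < m \<Longrightarrow> \<forall>\<^sub>F n in sequentially. k < scaled a n"
    and hi: "\<And>k. M < k \<Longrightarrow> \<forall>\<^sub>F n in sequentially. scaled a n < k"
    by (rule bounded_liminf_limsup_real[of 0 "scaled a" 1, OF scaled_nonneg scaled_le_1]) (rule that)
  have nonneg: "m \<ge> 0" "M \<ge> 0"
    by (rule LIMSEQ_le_const[OF rs(2)] LIMSEQ_le_const[OF rs(4)]; simp add: scaled_nonneg)+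
  obtain p q where pq: "p \<in> {m..M}" "q \<in> {m..M}" "3 * m * (sqrt (m + p) + sqrt (m + q)) = 1"
    by (rule scaled_subseq_limit[OF rs(1,2) lo hi])
  \<comment> \<open>At the lower limit, p and q are replaced by their upper bound M.\<close>
  have "3 * m * (sqrt (m + p) + sqrt (m + q)) \<le> 3 * m * (sqrt (m + M) + sqrt (m + M))"
    using pq nonneg by (intro mult_left_mono add_mono) auto
  then have 1: "1 \<le> 6 * m * sqrt (m + M)"
    using pq by simp
  obtain p' q' where pq': "p' \<in> {m..M}" "q' \<in> {m..M}" "3 * M * (sqrt (M + p') + sqrt (M + q')) = 1"
    by (rule scaled_subseq_limit[OF rs(3,4) lo hi])
  \<comment> \<open>At the upper limit, they are replaced by their lower bound m, giving the
    opposite inequality with the same root.\<close>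
  have "3 * M * (sqrt (M + m) + sqrt (M + m)) \<le> 3 * M * (sqrt (M + p') + sqrt (M + q'))"
    using pq' nonneg by (intro mult_left_mono add_mono) auto
  then have 2: "6 * M * sqrt (m + M) \<le> 1"
    using pq' by (simp add: add.commute)
  have pos: "m > 0"
    using 1 nonneg by (cases "m = 0") auto
  have "M * sqrt (m + M) \<le> m * sqrt (m + M)"
    using 1 2 by linarith
  then have "M \<le> m"
    using pos nonneg by simp
  \<comment> \<open>The reverse inequality m \<le> M holds because the interval contains p.\<close>
  then have [simp]: "M = m"
    using pq by auto
  have lim: "scaled a \<longlonglongrightarrow> m"
    using lo hi by (intro order_tendstoI) auto
  have "6 * m * sqrt (2 * m) = 1"
    using 1 2 by (simp flip: mult_2)
  then have "(6 * m * sqrt (2 * m))\<^sup>2 = 1"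
    by simp
  then have "36 * m\<^sup>2 * (2 * m) = 1"
    using pos by (simp add: power_mult_distrib)
  \<comment> \<open>From 72 m^3 = 1. Since 9 is the cube of 3^(2/3), uniqueness of nonnegative cube
    roots then determines m.\<close>
  then have "(2 * m) ^ 3 = 1 / 9"
    by (simp add: power2_eq_square power3_eq_cube)
  also have "\<dots> = (1 / 3 powr (2/3)) ^ 3"
    by (simp add: power_divide powr_power)
  finally have "2 * m = 1 / 3 powr (2/3)"
    using pos power_eq_imp_eq_base[of "2 * m" 3 "1 / 3 powr (2/3)"] by simp
  then have "m = 1 / (2 * 3 powr (2/3))"
    by (simp add: field_simps)
  then show ?thesis
    using lim by simp
qed

text \<open>By \<open>b_eq\<close> the quotient is a root whose argument tends to twice the limit of
  \<open>scaled a\<close>, that is to 3^(-2/3), with square root 3^(-1/3).\<close>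

lemma b_scaled_tendsto: "(\<lambda>n. b n / real n powr (1/3)) \<longlonglongrightarrow> 1 / 3 powr (1/3)"
proof -
  let ?m = "1 / (2 * 3 powr (2/3)) :: real"
  have "(\<lambda>n. real (Suc n) / real n) \<longlonglongrightarrow> 1"
    by real_asymp
  then have "(\<lambda>n. sqrt (scaled a n + scaled a (Suc n) * (real (Suc n) / real n) powr (2/3)))
    \<longlonglongrightarrow> sqrt (?m + ?m * 1 powr (2/3))"
    by (intro tendsto_intros scaled_tendsto LIMSEQ_Suc) auto
  moreover have "sqrt (?m + ?m * 1 powr (2/3)) = 1 / 3 powr (1/3)"
    by (simp add: real_sqrt_divide powr_powr flip: powr_half_sqrt)
  moreover have "\<forall>\<^sub>F n in sequentially. b n / real n powr (1/3) =
      sqrt (scaled a n + scaled a (Suc n) * (real (Suc n) / real n) powr (2/3))"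
    using eventually_ge_at_top[of 1] by eventually_elim (simp add: b_eq(1))
  ultimately show ?thesis
    by (simp add: tendsto_cong)
qed

end

theorem proposition3p1:
  fixes a b :: "nat \<Rightarrow> real"
  assumes "positive_solution a b"
  shows "(\<lambda>n. a n / real n powr (2/3)) \<longlonglongrightarrow> 1 / (2 * 3 powr (2/3))
       \<and> (\<lambda>n. b n / real n powr (1/3)) \<longlonglongrightarrow> 1 / 3 powr (1/3)"
  using scaled_tendsto[OF assms] b_scaled_tendsto[OF assms] by (simp add: scaled_def[abs_def])

end
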